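(* The binary operation $(x,y)\mapsto x+y$ on $\mathbb{N}$ does not belong to $\langle x\bmod y,\ 2^x\rangle$.
   Context: $\mathbb{N}$ is the set of non-negative integers. An ($r$-ary, $r\ge 1$) operation on $\mathbb{N}$ is a function $\mathbb{N}^r\to\mathbb{N}$. Conventions: $\lfloor x/0\rfloor:=0$, and $x\bmod y:=\max(x-y\lfloor x/y\rfloor,0)$, so that $x\bmod 0=x$. A set $S$ of operations on $\mathbb{N}$ is closed under substitution if, whenever $f\in S$ is $r$-ary and $g_1,\dots,g_r\in S$ are $n$-ary, the operation $\vec x\mapsto f(g_1(\vec x),\dots,g_r(\vec x))$ is in $S$. For a set $\mathcal{B}$ of operations on $\mathbb{N}$, $\langle\mathcal{B}\rangle$ denotes the closure under substitution of $\mathcal{B}\cup C\cup P$, where $C$ is the set of all constant operations on $\mathbb{N}$ (of every arity) and $P$ is the set of all projections $(x_1,\dots,x_n)\mapsto x_i$. Here $x \bmod y$ denotes the binary operation $(x,y)\mapsto x\bmod y$ and $2^x$ the unary operation $x\mapsto 2^x$. *)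

theory Defs
  imports Complex_Main "HOL-Library.FuncSet"
begin

definition tuples :: "nat \<Rightarrow> nat list set" where
  "tuples r = {xs. length xs = r}"

text \<open>An operation is a pair of its arity and a function on tuples.  Restricting the function to
  tuples of the right length makes equality of such pairs the usual extensional equality; the
  explicit arity is needed because a restricted function does not determine its domain.\<close>

type_synonym operation = "nat \<times> (nat list \<Rightarrow> nat)"

definition operations :: "operation set" where
  "operations = (SIGMA r:{1..}. tuples r \<rightarrow>\<^sub>E UNIV)"

definition mk_op :: "nat \<Rightarrow> (nat list \<Rightarrow> nat) \<Rightarrow> operation" where
  "mk_op r f = (r, restrict f (tuples r))"

definition unary_op :: "(nat \<Rightarrow> nat) \<Rightarrow> operation" where
  "unary_op h = mk_op 1 (\<lambda>xs. h (xs ! 0))"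

definition binary_op :: "(nat \<Rightarrow> nat \<Rightarrow> nat) \<Rightarrow> operation" where
  "binary_op h = mk_op 2 (\<lambda>xs. h (xs ! 0) (xs ! 1))"

definition constant_ops :: "operation set" where
  "constant_ops = {mk_op n (\<lambda>xs. c) | n c. n \<ge> 1}"

definition projection_ops :: "operation set" where
  "projection_ops = {mk_op n (\<lambda>xs. xs ! i) | n i. i < n}"

definition substitution_closed :: "operation set \<Rightarrow> bool" where
  "substitution_closed S \<longleftrightarrow> S \<subseteq> operations \<and>
     (\<forall>r f n gs. (r, f) \<in> S \<and> length gs = r \<and> (\<forall>g\<in>set gs. (n, g) \<in> S) \<longrightarrow>
        mk_op n (\<lambda>xs. f (map (\<lambda>g. g xs) gs)) \<in> S)"

text \<open>Meaningful for sets of operations \<open>B \<subseteq> operations\<close> only; by the definition of \<open>hull\<close>, this is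
  then the least substitution-closed set that contains \<open>B\<close>, the constants and the projections.\<close>

definition subst_closure :: "operation set \<Rightarrow> operation set" where
  "subst_closure B = substitution_closed hull (B \<union> constant_ops \<union> projection_ops)"

lemma mk_op_in_operations: "n \<ge> 1 \<Longrightarrow> mk_op n f \<in> operations"
  by (simp add: mk_op_def operations_def)

lemma substitution_closed_operations: "substitution_closed operations"
proof -
  have "mk_op n (\<lambda>xs. f (map (\<lambda>g. g xs) gs)) \<in> operations"
    if "(r, f) \<in> operations" "length gs = r" "\<forall>g\<in>set gs. (n, g) \<in> operations" for r f n gs
  proof -
    from that(1,2) have "gs \<noteq> []" by (auto simp: operations_def)
    then have "(n, hd gs) \<in> operations" using that(3) by simp
    then show ?thesis by (intro mk_op_in_operations) (simp add: operations_def)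
  qed
  then show ?thesis unfolding substitution_closed_def by blast
qed

lemma substitution_closed_subst_closure:
  assumes "B \<subseteq> operations"
  shows "substitution_closed (subst_closure B)"
proof -
  have sub: "B \<union> constant_ops \<union> projection_ops \<subseteq> operations"
    using assms by (auto simp: constant_ops_def projection_ops_def intro!: mk_op_in_operations)
  then have "subst_closure B \<subseteq> operations"
    unfolding subst_closure_def by (intro hull_minimal substitution_closed_operations)
  moreover have "mk_op n (\<lambda>xs. f (map (\<lambda>g. g xs) gs)) \<in> subst_closure B"
    if "(r, f) \<in> subst_closure B" "length gs = r" "\<forall>g\<in>set gs. (n, g) \<in> subst_closure B" for r f n gs
    unfolding subst_closure_def hull_def
  proof (intro InterI, clarify)
    fix t assume t: "substitution_closed t" "B \<union> constant_ops \<union> projection_ops \<subseteq> t"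
    then have "subst_closure B \<subseteq> t"
      unfolding subst_closure_def by (intro hull_minimal)
    with that have "(r, f) \<in> t" "\<forall>g\<in>set gs. (n, g) \<in> t" by auto
    with that(2) t(1) show "mk_op n (\<lambda>xs. f (map (\<lambda>g. g xs) gs)) \<in> t"
      unfolding substitution_closed_def by blast
  qed
  ultimately show ?thesis unfolding substitution_closed_def by blast
qed

text \<open>The remainder on \<^typ>\<open>nat\<close> obeys the convention \<open>\<lfloor>x / 0\<rfloor> = 0\<close>, hence \<open>x mod 0 = x\<close>.\<close>

lemma int_mod_eq_floor:
  fixes x y :: nat
  shows "int (x mod y) = max (int x - int y * \<lfloor>real x / real y\<rfloor>) 0"
proof -
  have "\<lfloor>real x / real y\<rfloor> = int (x div y)"
    by (simp add: floor_divide_of_nat_eq)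
  moreover have "int (x mod y) = int x - int y * int (x div y)"
    by (simp add: minus_mult_div_eq_mod zmod_int zdiv_int)
  ultimately show ?thesis by simp
qed

end

theory Submission
  imports Defs
begin

text \<open>Evaluate operations along the sequence of towers of twos.  Modulo any fixed positive number
  the towers are eventually constant, and of two towers one divides the other.  Hence the sequences
  that are eventually constant or eventually a shift of the tower sequence are stable under
  \<open>x mod y\<close> and \<open>2 ^ x\<close>.  The sequence of towers plus one is neither: it is unbounded and
  eventually odd.\<close>

section \<open>Growth and divisibility of towers of twos\<close>

primrec tower :: "nat \<Rightarrow> nat" where
  "tower 0 = 1"
| "tower (Suc k) = 2 ^ tower k"

lemma strict_mono_tower: "strict_mono tower"
  by (simp add: strict_mono_Suc_iff)

text \<open>Beyond \<open>tower 0 = 1\<close>, towers are powers of two whose exponents are again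
  towers, hence increasing.\<close>

lemma tower_dvd_tower:
  assumes "j \<le> k"
  shows "tower j dvd tower k"
proof (cases j)
  case (Suc i)
  with assms obtain l where k: "k = Suc l" "i \<le> l" by (cases k) auto
  then have "tower i \<le> tower l"
    using strict_mono_tower by (simp add: strict_mono_less_eq)
  with Suc k show ?thesis by (simp add: le_imp_power_dvd)
qed simp

lemma eventually_tower_add_ge: "eventually (\<lambda>k. tower (k + m) \<ge> b) sequentially"
proof (rule eventually_sequentiallyI)
  fix k assume "b \<le> k"
  moreover have "k + m \<le> tower (k + m)"
    by (rule strict_mono_imp_increasing[OF strict_mono_tower])
  ultimately show "b \<le> tower (k + m)" by linarith
qed

section \<open>Residues of powers of two and of towers\<close>

text \<open>If \<open>d\<close> divides no power of two, the residue 0 is never attained, and the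
  pigeonhole principle yields a period strictly below \<open>d\<close>. This strict descent drives
  the induction for towers.\<close>

lemma power_two_mod_cases:
  fixes d :: nat
  assumes "d > 0"
  obtains (zero) i where "\<And>n. n \<ge> i \<Longrightarrow> 2 ^ n mod d = 0"
  | (periodic) i p where "0 < p" "p < d"
      "\<And>m n. \<lbrakk>m \<ge> i; n \<ge> i; m mod p = n mod p\<rbrakk> \<Longrightarrow> (2::nat) ^ m mod d = 2 ^ n mod d"
proof (cases "\<exists>i. d dvd 2 ^ i")
  case True
  then obtain i where "d dvd 2 ^ i" by blast
  then have "(2::nat) ^ n mod d = 0" if "n \<ge> i" for n
    using that by (meson dvd_trans le_imp_power_dvd dvd_imp_mod_0)
  then show ?thesis by (rule zero)
next
  case False
  \<comment> \<open>Excluding 0 leaves \<open>d - 1\<close> residues for \<open>d\<close> exponents,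
    so two exponents below \<open>d\<close> collide.\<close>
  have "(\<lambda>n. 2 ^ n mod d) ` {..<d} \<subseteq> {1..<d}"
    using False assms by (auto simp: Suc_le_eq mod_greater_zero_iff_not_dvd)
  then have "card ((\<lambda>n. (2::nat) ^ n mod d) ` {..<d}) \<le> card {1..<d}"
    by (intro card_mono) auto
  with assms have "\<not> inj_on (\<lambda>n. (2::nat) ^ n mod d) {..<d}"
    by (intro pigeonhole) simp
  then obtain i j where ij: "i < j" "j < d" "(2::nat) ^ i mod d = 2 ^ j mod d"
    unfolding inj_on_def by (metis lessThan_iff linorder_neqE_nat)
  define p where "p = j - i"
  have step: "(2::nat) ^ (n + p) mod d = 2 ^ n mod d" if "n \<ge> i" for n
  proof -
    have "(2::nat) ^ (n + p) mod d = (2 ^ (n - i) * 2 ^ j) mod d"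
      using that ij by (simp add: p_def flip: power_add)
    also have "\<dots> = (2 ^ (n - i) * 2 ^ i) mod d"
      using ij by (metis mod_mult_right_eq)
    finally show ?thesis using that by (simp flip: power_add)
  qed
  have steps: "(2::nat) ^ (n + p * q) mod d = 2 ^ n mod d" if "n \<ge> i" for n q
  proof (induction q)
    case (Suc q)
    then show ?case
      using step[of "n + p * q"] that by (simp add: algebra_simps)
  qed simp
  have le: "(2::nat) ^ m mod d = 2 ^ n mod d"
    if "m \<ge> i" "m \<le> n" "m mod p = n mod p" for m n
  proof -
    have "p dvd n - m" using that by (metis mod_eq_dvd_iff_nat)
    then obtain q where "n - m = p * q" by (rule dvdE)
    with that have "n = m + p * q" by linarith
    then show ?thesis using steps that by simp
  qed
  show ?thesis
  proof (rule periodic)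
    show "0 < p" "p < d" using ij by (auto simp: p_def)
    show "(2::nat) ^ m mod d = 2 ^ n mod d" if "m \<ge> i" "n \<ge> i" "m mod p = n mod p" for m n
      using that le by (metis nat_le_linear)
  qed
qed

text \<open>Strong induction on the modulus: once the exponent \<open>tower k\<close> is large,
  \<open>2 ^ tower k mod d\<close> depends only on \<open>tower k mod p\<close> for a period
  \<open>p < d\<close>, and that residue stabilizes by the induction hypothesis.\<close>

lemma tower_mod_eventually_const:
  assumes "d > 0"
  shows "\<exists>c. eventually (\<lambda>k. tower k mod d = c) sequentially"
  using assms
proof (induction d rule: less_induct)
  case (less d)
  have large: "eventually (\<lambda>k. tower k \<ge> b) sequentially" for b
    using eventually_tower_add_ge[of b 0] by simp
  \<comment> \<open>The index shift turns every term into a power of two; eventual statements are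
    insensitive to it.\<close>
  have "\<exists>c. eventually (\<lambda>k. tower (Suc k) mod d = c) sequentially"
    using \<open>d > 0\<close>
  proof (cases rule: power_two_mod_cases)
    case (zero i)
    then have "eventually (\<lambda>k. tower (Suc k) mod d = 0) sequentially"
      using large[of i] by (auto elim: eventually_mono)
    then show ?thesis by blast
  next
    case (periodic i p)
    then obtain r where "eventually (\<lambda>k. tower k mod p = r) sequentially"
      using less.IH by blast
    with large[of i] have "eventually (\<lambda>k. tower k \<ge> i \<and> tower k mod p = r) sequentially"
      by (rule eventually_conj)
    then obtain N where N: "\<And>k. k \<ge> N \<Longrightarrow> tower k \<ge> i \<and> tower k mod p = r"
      by (auto simp: eventually_sequentially)
    have "tower (Suc k) mod d = tower (Suc N) mod d" if "k \<ge> N" for k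
      using N[OF that] N[of N] periodic(3) by simp
    then show ?thesis by (auto simp: eventually_sequentially)
  qed
  then show ?case
    using eventually_sequentially_Suc[of "\<lambda>k. tower k mod d = c" for c] by blast
qed

section \<open>Tower-like sequences and their stability\<close>

text \<open>The shift \<open>m\<close> absorbs exponentiation, which increases it by one. Only
  eventual behaviour counts, since residues of towers settle late.\<close>

definition tower_like :: "(nat \<Rightarrow> nat) \<Rightarrow> bool" where
  "tower_like u \<longleftrightarrow> (\<exists>c. eventually (\<lambda>k. u k = c) sequentially) \<or>
     (\<exists>m. eventually (\<lambda>k. u k = tower (k + m)) sequentially)"

lemma tower_like_const: "tower_like (\<lambda>k. c)"
  by (auto simp: tower_like_def)

lemma tower_like_tower_add: "tower_like (\<lambda>k. tower (k + m))"
  unfolding tower_like_def by (intro disjI2 exI[of _ m]) simp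

lemma tower_like_cong:
  assumes "eventually (\<lambda>k. u k = v k) sequentially" "tower_like v"
  shows "tower_like u"
proof -
  have iff: "eventually (\<lambda>k. u k = w k) sequentially \<longleftrightarrow> eventually (\<lambda>k. v k = w k) sequentially"
    for w
    using assms(1) by (intro eventually_subst) (auto elim: eventually_mono)
  show ?thesis
    using assms(2) unfolding tower_like_def iff .
qed

lemma tower_like_cases:
  assumes "tower_like u"
  obtains (const) c where "eventually (\<lambda>k. u k = c) sequentially"
  | (tower) m where "eventually (\<lambda>k. u k = tower (k + m)) sequentially"
  using assms by (auto simp: tower_like_def)

lemma tower_like_power_two:
  assumes "tower_like u"
  shows "tower_like (\<lambda>k. 2 ^ u k)"
  using assms
proof (cases rule: tower_like_cases)
  case (const c)
  then show ?thesis
    by (intro tower_like_cong[OF _ tower_like_const[of "2 ^ c"]]) (auto elim: eventually_mono)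
next
  case (tower m)
  then show ?thesis
    by (intro tower_like_cong[OF _ tower_like_tower_add[of "Suc m"]]) (auto elim: eventually_mono)
qed

text \<open>For \<open>d > 0\<close> the residues stabilize; for \<open>d = 0\<close> the convention
  \<open>x mod 0 = x\<close> returns the shifted tower itself.\<close>

lemma tower_like_tower_mod_const: "tower_like (\<lambda>k. tower (k + m) mod d)"
proof (cases "d = 0")
  case False
  then obtain c where "eventually (\<lambda>k. tower k mod d = c) sequentially"
    using tower_mod_eventually_const by blast
  then have "eventually (\<lambda>k. tower (k + m) mod d = c) sequentially"
    by (rule sequentially_offset)
  then show ?thesis by (auto simp: tower_like_def)
qed (simp add: tower_like_tower_add)

text \<open>Either the divisor divides the dividend and the remainder is 0, or it is larger and the
  remainder is the dividend.\<close>

lemma tower_like_tower_mod_tower: "tower_like (\<lambda>k. tower (k + m) mod tower (k + n))"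
proof (cases "n \<le> m")
  case True
  then have "tower (k + m) mod tower (k + n) = 0" for k
    by (simp add: tower_dvd_tower)
  then show ?thesis by (simp add: tower_like_const)
next
  case False
  then have "tower (k + m) mod tower (k + n) = tower (k + m)" for k
    using strict_mono_tower by (simp add: strict_mono_less)
  then show ?thesis by (simp add: tower_like_tower_add)
qed

lemma tower_like_mod:
  assumes "tower_like u" "tower_like v"
  shows "tower_like (\<lambda>k. u k mod v k)"
  using assms(1)
proof (cases rule: tower_like_cases)
  case u: (const c)
  from assms(2) show ?thesis
  proof (cases rule: tower_like_cases)
    case (const d)
    with u have "eventually (\<lambda>k. u k mod v k = c mod d) sequentially"
      by eventually_elim simp
    then show ?thesis by (rule tower_like_cong[OF _ tower_like_const])
  next
    case (tower n)
    \<comment> \<open>\<open>Suc c\<close> makes the divisor strictly larger than \<open>c\<close>,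
      so the remainder is \<open>c\<close>.\<close>
    with u eventually_tower_add_ge[of "Suc c" n]
    have "eventually (\<lambda>k. u k mod v k = c) sequentially"
      by eventually_elim simp
    then show ?thesis by (rule tower_like_cong[OF _ tower_like_const])
  qed
next
  case u: (tower m)
  from assms(2) show ?thesis
  proof (cases rule: tower_like_cases)
    case (const d)
    with u have "eventually (\<lambda>k. u k mod v k = tower (k + m) mod d) sequentially"
      by eventually_elim simp
    then show ?thesis by (rule tower_like_cong[OF _ tower_like_tower_mod_const])
  next
    case (tower n)
    with u have "eventually (\<lambda>k. u k mod v k = tower (k + m) mod tower (k + n)) sequentially"
      by eventually_elim simp
    then show ?thesis by (rule tower_like_cong[OF _ tower_like_tower_mod_tower])
  qed
qed

lemma not_tower_like_tower_plus_one: "\<not> tower_like (\<lambda>k. tower k + 1)"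
proof
  assume "tower_like (\<lambda>k. tower k + 1)"
  then show False
  proof (cases rule: tower_like_cases)
    case (const c)
    with eventually_tower_add_ge[of c 0] have "eventually (\<lambda>k. False) sequentially"
      by eventually_elim simp
    then show False by simp
  next
    case (tower m)
    \<comment> \<open>\<open>tower 1 = 2\<close> divides all later towers, whereas
      \<open>tower 0 = 1\<close> is odd; hence the restriction to \<open>k \<ge> 1\<close>
      below.\<close>
    have even: "even (tower j)" if "j \<ge> 1" for j
      using tower_dvd_tower[OF that] by simp
    from tower eventually_ge_at_top[of 1] have "eventually (\<lambda>k. False) sequentially"
    proof eventually_elim
      case (elim k)
      then have "even (tower k)" "even (tower k + 1)"
        using even[of k] even[of "k + m"] by auto
      then show False by simp
    qed
    then show False by simp
  qed
qed

section \<open>Operations preserving tower-like sequences\<close>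

text \<open>These are the polymorphisms of the set of tower-like sequences, seen as a relation of
  countable arity on the naturals; operations act on sequences pointwise.\<close>

definition tower_like_ops :: "operation set" where
  "tower_like_ops = {(r, f) \<in> operations. \<forall>us. length us = r \<and> (\<forall>u\<in>set us. tower_like u) \<longrightarrow>
     tower_like (\<lambda>k. f (map (\<lambda>u. u k) us))}"

lemma mk_op_mem_tower_like_ops_iff:
  assumes "r \<ge> 1"
  shows "mk_op r f \<in> tower_like_ops \<longleftrightarrow>
    (\<forall>us. length us = r \<and> (\<forall>u\<in>set us. tower_like u) \<longrightarrow> tower_like (\<lambda>k. f (map (\<lambda>u. u k) us)))"
proof -
  have "restrict f (tuples r) (map (\<lambda>u. u k) us) = f (map (\<lambda>u. u k) us)"
    if "length us = r" for us :: "(nat \<Rightarrow> nat) list" and k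
    using that by (simp add: tuples_def)
  with mk_op_in_operations[OF assms, of f] show ?thesis
    by (auto simp: tower_like_ops_def mk_op_def cong: conj_cong)
qed

lemma substitution_closed_tower_like_ops: "substitution_closed tower_like_ops"
proof -
  have "mk_op n (\<lambda>xs. f (map (\<lambda>g. g xs) gs)) \<in> tower_like_ops"
    if f: "(r, f) \<in> tower_like_ops" and len: "length gs = r"
      and gs: "\<forall>g\<in>set gs. (n, g) \<in> tower_like_ops" for r f n gs
  proof -
    \<comment> \<open>Since \<open>r\<close> is positive, some inner operation exists, and it
      witnesses that the arity \<open>n\<close> is positive.\<close>
    have "r \<ge> 1" using f by (auto simp: tower_like_ops_def operations_def)
    with len have "gs \<noteq> []" by auto
    with gs have "(n, hd gs) \<in> tower_like_ops" by simp
    then have "n \<ge> 1" by (auto simp: tower_like_ops_def operations_def)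
    moreover have "tower_like (\<lambda>k. f (map (\<lambda>g. g (map (\<lambda>u. u k) us)) gs))"
      if us: "length us = n" "\<forall>u\<in>set us. tower_like u" for us
    proof -
      \<comment> \<open>The inner operations turn \<open>us\<close> into tower-like sequences, to
        which the outer \<open>f\<close> is then applied.\<close>
      define vs where "vs = map (\<lambda>g k. g (map (\<lambda>u. u k) us)) gs"
      have "\<forall>v\<in>set vs. tower_like v"
        using gs us by (auto simp: vs_def tower_like_ops_def)
      moreover have "length vs = r" using len by (simp add: vs_def)
      ultimately have "tower_like (\<lambda>k. f (map (\<lambda>v. v k) vs))"
        using f by (auto simp: tower_like_ops_def)
      then show ?thesis by (simp add: vs_def comp_def)
    qed
    ultimately show ?thesis by (simp add: mk_op_mem_tower_like_ops_iff)
  qed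
  moreover have "tower_like_ops \<subseteq> operations" by (auto simp: tower_like_ops_def)
  ultimately show ?thesis unfolding substitution_closed_def by blast
qed

lemma subst_closure_subset_tower_like_ops:
  "subst_closure {binary_op (\<lambda>x y. x mod y), unary_op (\<lambda>x. 2 ^ x)} \<subseteq> tower_like_ops"
  unfolding subst_closure_def
proof (intro hull_minimal substitution_closed_tower_like_ops Un_least)
  show "{binary_op (\<lambda>x y. x mod y), unary_op (\<lambda>x. 2 ^ x)} \<subseteq> tower_like_ops"
    by (auto simp: binary_op_def unary_op_def mk_op_mem_tower_like_ops_iff
        intro!: tower_like_mod tower_like_power_two)
  show "constant_ops \<subseteq> tower_like_ops"
    by (auto simp: constant_ops_def mk_op_mem_tower_like_ops_iff tower_like_const)
  show "projection_ops \<subseteq> tower_like_ops"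
    by (auto simp: projection_ops_def mk_op_mem_tower_like_ops_iff)
qed

theorem theorem6:
  shows "binary_op (\<lambda>x y. x + y)
           \<notin> subst_closure {binary_op (\<lambda>x y. x mod y), unary_op (\<lambda>x. 2 ^ x)}"
proof
  assume "binary_op (\<lambda>x y. x + y)
            \<in> subst_closure {binary_op (\<lambda>x y. x mod y), unary_op (\<lambda>x. 2 ^ x)}"
  then have "mk_op 2 (\<lambda>xs. xs ! 0 + xs ! 1) \<in> tower_like_ops"
    using subst_closure_subset_tower_like_ops by (auto simp: binary_op_def)
  then have "tower_like (\<lambda>k. map (\<lambda>u. u k) us ! 0 + map (\<lambda>u. u k) us ! 1)"
    if "length us = 2" "\<forall>u\<in>set us. tower_like u" for us
    using that by (simp add: mk_op_mem_tower_like_ops_iff)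
  \<comment> \<open>Both arguments are tower-like, but adding 1 destroys the parity of towers
    without bounding them.\<close>
  from this[of "[tower, \<lambda>k. 1]"] have "tower_like (\<lambda>k. tower k + 1)"
    using tower_like_tower_add[of 0] tower_like_const[of 1] by simp
  then show False using not_tower_like_tower_plus_one by simp
qed

end
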